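(* Let $n\ge1$ and let $F=F_{a,b,c}$ be the non-Riemannian $U(n+1)$-invariant Randers metric on $S^{2n+1}=U(n+1)/U(n)$ determined by real parameters $a,b>0$ and $c$ with $0<|c|<\sqrt a$. Then there exists an element $X\in\mathfrak{u}(n+1)$, not in the center of $\mathfrak{u}(n+1)$, that generates a non-vanishing Killing vector field of constant $F$-length if and only if $a=b+c^2$. Moreover, when $a=b+c^2$, for each $L>0$ the Killing vector fields of constant length $L$ generated by non-central elements of $\mathfrak{u}(n+1)$ are in one-to-one correspondence with (namely, are those generated by) the skew-Hermitian matrices $X\in\mathfrak{u}(n+1)$ having exactly two distinct eigenvalues, these eigenvalues being $$\left(-\frac{Lc}{b}\pm\sqrt{\frac{L^2}{b}+\frac{L^2c^2}{b^2}}\right)\sqrt{-1}.$$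
   Context: $S^{2n+1}$ is the unit sphere in $\mathbb{C}^{n+1}$ with the standard linear action of $U(n+1)$; $\mathfrak{u}(n+1)$ is the Lie algebra of skew-Hermitian matrices, with center $\sqrt{-1}\,\mathbb{R}I$. The Killing vector field generated by $X\in\mathfrak{u}(n+1)$ is $z\mapsto Xz$; it has constant length $L$ if $F(z,Xz)=L$ for all $z\in S^{2n+1}$. The metric $F_{a,b,c}$: at the base point $e_{n+1}=(0,\dots,0,1)^T$ identify the tangent space with $\mathbb{R}\oplus\mathbb{C}^n\ni(q,u)$, the pair $(q,u)$ corresponding to the tangent vector $(u,\sqrt{-1}q)\in\mathbb{C}^n\oplus\mathbb{C}$, and put $F_{a,b,c}(q,u)=\sqrt{a q^2+b\,u^*u}+c\,q$, extended to $S^{2n+1}$ by $U(n+1)$-invariance. Equivalently, for $z\in S^{2n+1}$ and a tangent vector $w$ at $z$, with $q=\operatorname{Im}(z^*w)$, $F_{a,b,c}(z,w)=\sqrt{a q^2+b|w-\sqrt{-1}qz|^2}+cq$. These are exactly the non-Riemannian $U(n+1)$-invariant Randers metrics (a Randers metric being $\alpha+\beta$ with $\alpha$ Riemannian and $\beta$ a 1-form of $\alpha$-length everywhere $<1$; non-Riemannian means $\beta\ne0$). *)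

theory Defs
  imports "HOL-Analysis.Analysis"
begin

text \<open>
  Vectors of the complex space of dimension \<open>n + 1\<close> are elements of \<^typ>\<open>complex ^ 'm\<close> with
  \<open>CARD('m) = n + 1\<close>; the unit sphere is \<open>sphere 0 1\<close> for the standard norm.
\<close>

definition cadjoint :: "complex ^ 'm ^ 'm \<Rightarrow> complex ^ 'm ^ 'm" where
  "cadjoint A = (\<chi> i j. cnj (A $ j $ i))"

definition hprod :: "complex ^ 'm \<Rightarrow> complex ^ 'm \<Rightarrow> complex" where
  "hprod z w = (\<Sum>i\<in>UNIV. cnj (z $ i) * w $ i)"

definition \<uu> :: "(complex ^ 'm ^ 'm) set" where
  "\<uu> = {X. cadjoint X = - X}"

definition lie_bracket :: "complex ^ 'm ^ 'm \<Rightarrow> complex ^ 'm ^ 'm \<Rightarrow> complex ^ 'm ^ 'm" where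
  "lie_bracket X Y = X ** Y - Y ** X"

definition center_\<uu> :: "(complex ^ 'm ^ 'm) set" where
  "center_\<uu> = {X \<in> \<uu>. \<forall>Y\<in>\<uu>. lie_bracket X Y = 0}"

definition eigenvalues :: "complex ^ 'm ^ 'm \<Rightarrow> complex set" where
  "eigenvalues X = {l. \<exists>v. v \<noteq> 0 \<and> X *v v = l *s v}"

text \<open>
  The metric, as a function of a point \<open>z\<close> of the sphere and a tangent vector \<open>w\<close> at \<open>z\<close>.
  It is the \<open>U(n+1)\<close>-invariant extension (\<open>randers_invariant\<close>) of its value at the base point
  \<open>axis k 1\<close>, where the tangent vector \<open>w\<close> corresponds to the pair \<open>(q, u)\<close> with
  \<open>w $ k = \<i> q\<close> and \<open>u\<close> the vector of the remaining components (\<open>randers_base_point\<close>).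
\<close>

definition randers ::
    "real \<Rightarrow> real \<Rightarrow> real \<Rightarrow> complex ^ 'm \<Rightarrow> complex ^ 'm \<Rightarrow> real" where
  "randers a b c z w =
     (let q = Im (hprod z w)
      in sqrt (a * q\<^sup>2 + b * (norm (w - (\<i> * complex_of_real q) *s z))\<^sup>2) + c * q)"

text \<open>A vector field on the sphere is a function that is \<^const>\<open>undefined\<close> off the sphere.\<close>

definition killing_field :: "complex ^ 'm ^ 'm \<Rightarrow> complex ^ 'm \<Rightarrow> complex ^ 'm" where
  "killing_field X = restrict (\<lambda>z. X *v z) (sphere 0 1)"

definition nonvanishing :: "(complex ^ 'm \<Rightarrow> complex ^ 'm) \<Rightarrow> bool" where
  "nonvanishing V \<longleftrightarrow> (\<forall>z \<in> sphere 0 1. V z \<noteq> 0)"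

definition has_constant_length ::
    "(complex ^ 'm \<Rightarrow> complex ^ 'm \<Rightarrow> real) \<Rightarrow> (complex ^ 'm \<Rightarrow> complex ^ 'm) \<Rightarrow> real \<Rightarrow> bool" where
  "has_constant_length F V L \<longleftrightarrow> (\<forall>z \<in> sphere 0 1. F z (V z) = L)"

lemma norm_sq_vec: "(norm (v :: complex ^ 'm))\<^sup>2 = (\<Sum>i\<in>UNIV. (cmod (v $ i))\<^sup>2)"
  by (simp add: norm_vec_def L2_set_def sum_nonneg)

lemma hprod_self: "hprod v v = complex_of_real ((norm v)\<^sup>2)"
proof -
  have "cnj x * x = complex_of_real ((cmod x)\<^sup>2)" for x
    by (metis complex_norm_square mult.commute)
  then show ?thesis
    by (simp add: hprod_def norm_sq_vec)
qed

lemma hprod_matrix: "hprod (A *v z) w = hprod z (cadjoint A *v w)"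
proof -
  have "hprod (A *v z) w = (\<Sum>i\<in>UNIV. \<Sum>j\<in>UNIV. cnj (A $ i $ j) * cnj (z $ j) * w $ i)"
    by (simp add: hprod_def matrix_vector_mult_def sum_distrib_right)
  also have "\<dots> = (\<Sum>j\<in>UNIV. \<Sum>i\<in>UNIV. cnj (A $ i $ j) * cnj (z $ j) * w $ i)"
    by (rule sum.swap)
  also have "\<dots> = hprod z (cadjoint A *v w)"
    by (simp add: hprod_def matrix_vector_mult_def cadjoint_def sum_distrib_left mult_ac)
  finally show ?thesis .
qed

lemma hprod_unitary:
  assumes "cadjoint A ** A = mat 1"
  shows "hprod (A *v z) (A *v w) = hprod z w"
  by (simp add: hprod_matrix matrix_vector_mul_assoc assms)

lemma norm_unitary:
  assumes "cadjoint A ** A = mat 1"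
  shows "norm (A *v v) = norm v"
proof -
  have "complex_of_real ((norm (A *v v))\<^sup>2) = complex_of_real ((norm v)\<^sup>2)"
    using hprod_unitary[OF assms, of v v] by (simp only: hprod_self)
  then have "(norm (A *v v))\<^sup>2 = (norm v)\<^sup>2"
    by (simp only: of_real_eq_iff)
  then show ?thesis by simp
qed

lemma randers_invariant:
  assumes "cadjoint A ** A = mat 1"
  shows "randers a b c (A *v z) (A *v w) = randers a b c z w"
proof -
  have "A *v w - l *s (A *v z) = A *v (w - l *s z)" for l
    by (simp add: matrix_vector_mult_diff_distrib vector_scalar_commute)
  then show ?thesis
    by (simp add: randers_def hprod_unitary[OF assms] norm_unitary[OF assms])
qed

lemma randers_base_point:
  assumes "w $ k = \<i> * complex_of_real q"
  shows "randers a b c (axis k 1) w =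
    sqrt (a * q\<^sup>2 + b * (\<Sum>j\<in>UNIV - {k}. (cmod (w $ j))\<^sup>2)) + c * q"
proof -
  have "hprod (axis k 1) w = w $ k"
    by (simp add: hprod_def axis_def if_distrib if_distribR cong: if_cong)
  then have q: "Im (hprod (axis k 1) w) = q"
    using assms by simp
  let ?v = "w - (\<i> * complex_of_real q) *s axis k 1"
  have "(norm ?v)\<^sup>2 = (cmod (?v $ k))\<^sup>2 + (\<Sum>j\<in>UNIV - {k}. (cmod (?v $ j))\<^sup>2)"
    by (simp only: norm_sq_vec) (rule sum.remove, auto)
  also have "\<dots> = (\<Sum>j\<in>UNIV - {k}. (cmod (w $ j))\<^sup>2)"
    using assms by (simp add: axis_def)
  finally show ?thesis
    by (simp add: randers_def q)
qed

end

theory Submission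
  imports Defs
begin

text \<open>
  For \<open>X\<close> in \<open>\<uu>\<close> the operator \<open>T = - \<i> X\<close> is self-adjoint for the real inner product, and on the
  unit sphere the length of the field is
  \<open>sqrt ((a - b) (z \<bullet> T z)\<^sup>2 + b \<parallel>T z\<parallel>\<^sup>2) + c (z \<bullet> T z)\<close>.
  Squaring, constancy of the length says that
  \<open>(a - b - c\<^sup>2) (z \<bullet> T z)\<^sup>2 + (z \<bullet> (b T\<^sup>2 + 2 L c T - L\<^sup>2) z) = 0\<close> on the sphere.
  Along a circle through two orthogonal unit eigenvectors with eigenvalues \<open>x \<noteq> y\<close> only the first
  term is nonlinear in the squared coordinates, so \<open>a = b + c\<^sup>2\<close>. In that case the quadratic form
  must vanish, i.e. \<open>b T\<^sup>2 + 2 L c T - L\<^sup>2 = 0\<close>, and the eigenvalues of \<open>T\<close> are the two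
  roots of this polynomial; both occur unless \<open>X\<close> is central.
\<close>

section \<open>Self-adjoint operators\<close>

text \<open>Polarization: in the form at \<open>x + P x\<close> the cross terms amount to twice the
  squared norm of \<open>P x\<close>.\<close>

lemma selfadjoint_eq_0:
  fixes P :: "'a::real_inner \<Rightarrow> 'a"
  assumes "linear P" and sa: "\<And>x y. P x \<bullet> y = x \<bullet> P y" and "\<And>x. x \<bullet> P x = 0"
  shows "P x = 0"
proof -
  have "(x + P x) \<bullet> P (x + P x) = x \<bullet> P x + P x \<bullet> P (P x) + 2 * (P x \<bullet> P x)"
    by (simp add: linear_add[OF assms(1)] inner_add_left inner_add_right sa[symmetric])
  then show ?thesis
    using assms(3) by simp
qed

text \<open>A maximiser of the Rayleigh quotient over an invariant subspace is an eigenvector.\<close>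

lemma selfadjoint_eigenvector_in_subspace:
  fixes T :: "'a::euclidean_space \<Rightarrow> 'a"
  assumes lin: "linear T" and sa: "\<And>x y. T x \<bullet> y = x \<bullet> T y"
    and S: "subspace S" and inv: "\<And>x. x \<in> S \<Longrightarrow> T x \<in> S" and "u \<in> S" "u \<noteq> 0"
  obtains v l where "v \<in> S" "v \<noteq> 0" "T v = l *\<^sub>R v"
proof -
  let ?K = "sphere 0 1 \<inter> S"
  have "(1 / norm u) *\<^sub>R u \<in> ?K"
    using assms by (simp add: subspace_scale)
  moreover have "compact ?K"
    by (simp add: compact_Int_closed closed_subspace S)
  moreover have "continuous_on ?K (\<lambda>x. x \<bullet> T x)"
    using lin by (intro continuous_intros linear_continuous_on) (simp add: linear_conv_bounded_linear)
  ultimately obtain v where v: "v \<in> ?K" and max: "\<And>x. x \<in> ?K \<Longrightarrow> x \<bullet> T x \<le> v \<bullet> T v"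
    using continuous_attains_sup[of ?K "\<lambda>x. x \<bullet> T x"] by blast
  define l where "l = v \<bullet> T v"
  have vv: "v \<bullet> v = 1"
    using v by (simp add: norm_eq_1)
  \<comment> \<open>By maximality of \<open>l\<close>, \<open>A\<close> is positive semidefinite on
    \<open>S\<close>, and its form vanishes at \<open>v\<close>. Perturbing \<open>v\<close> in the
    direction \<open>A v\<close> then forces \<open>A v = 0\<close>.\<close>
  define A where "A x = l *\<^sub>R x - T x" for x
  have linA: "linear A"
    unfolding A_def by (intro linear_compose_sub lin linear_scale_self)
  have saA: "A x \<bullet> y = x \<bullet> A y" for x y
    by (simp add: A_def inner_diff_left inner_diff_right sa)
  have psd: "0 \<le> x \<bullet> A x" if "x \<in> S" for x
  proof (cases "x = 0")
    case False
    have "(1 / norm x) *\<^sub>R x \<in> ?K"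
      using that False S by (simp add: subspace_scale)
    from max[OF this] have "(x \<bullet> T x) / (norm x)\<^sup>2 \<le> l"
      by (simp add: linear_scale[OF lin] l_def power2_eq_square)
    then show ?thesis
      using False by (simp add: A_def inner_diff_right divide_le_eq dot_square_norm)
  qed simp
  define w where "w = A v"
  have wS: "w \<in> S" and vS: "v \<in> S"
    using v inv S by (auto simp: w_def A_def subspace_diff subspace_scale)
  have vAv: "v \<bullet> A v = 0"
    by (simp add: A_def inner_diff_right vv l_def)
  have quad: "0 \<le> 2 * t * (w \<bullet> w) + t\<^sup>2 * (w \<bullet> A w)" for t
  proof -
    have "v + t *\<^sub>R w \<in> S"
      using wS vS S by (simp add: subspace_add subspace_scale)
    from psd[OF this] show ?thesis
      using vAv saA[of v w]
      by (simp add: linear_add[OF linA] linear_scale[OF linA] inner_add_left inner_add_right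
          power2_eq_square algebra_simps flip: w_def)
  qed
  have "w = 0"
  proof (rule ccontr)
    assume "w \<noteq> 0"
    then have p: "0 < w \<bullet> w" by simp
    define r where "r = w \<bullet> A w"
    have r: "0 \<le> r" using psd[OF wS] by (simp add: r_def)
    \<comment> \<open>A negative \<open>t\<close> so small that the linear term of
      \<open>quad\<close> dominates; the denominator \<open>r + 1\<close> stays positive even when
      \<open>r = 0\<close>.\<close>
    define t where "t = - (w \<bullet> w) / (r + 1)"
    have "t < 0" using p r by (simp add: t_def field_simps)
    have "t * (2 * (w \<bullet> w) + t * r) \<ge> 0"
      using quad[of t] by (simp add: r_def algebra_simps power2_eq_square)
    then have "2 * (w \<bullet> w) + t * r \<le> 0"
      using \<open>t < 0\<close> by (simp add: zero_le_mult_iff)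
    moreover have "- t * r \<le> w \<bullet> w"
      using p r by (simp add: t_def field_simps)
    ultimately show False using p by linarith
  qed
  then have "T v = l *\<^sub>R v" by (simp add: w_def A_def)
  moreover have "v \<noteq> 0" using vv by auto
  ultimately show ?thesis using that vS by blast
qed

text \<open>Commutation makes the range of \<open>P\<close> invariant under \<open>T\<close>, so it
  contains an eigenvector. Self-adjointness of \<open>P\<close> makes its range meet its kernel only
  in 0.\<close>

lemma selfadjoint_commuting_eigenvector:
  fixes T P :: "'a::euclidean_space \<Rightarrow> 'a"
  assumes lin: "linear T" "linear P"
    and sa: "\<And>x y. T x \<bullet> y = x \<bullet> T y" "\<And>x y. P x \<bullet> y = x \<bullet> P y"
    and comm: "\<And>x. T (P x) = P (T x)" and "P u \<noteq> 0"
  obtains v l where "T v = l *\<^sub>R v" "P v \<noteq> 0"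
proof -
  have "subspace (range P)"
    by (simp add: lin linear_subspace_image)
  then obtain v l where v: "v \<in> range P" "v \<noteq> 0" "T v = l *\<^sub>R v"
    using selfadjoint_eigenvector_in_subspace[OF lin(1) sa(1), of "range P" "P u"] assms(6) comm
    by (metis (no_types, lifting) rangeE rangeI)
  moreover have "P v \<noteq> 0"
  proof
    assume "P v = 0"
    obtain x where "v = P x" using v by blast
    then have "v \<bullet> v = x \<bullet> P v" by (simp add: sa)
    then show False using v \<open>P v = 0\<close> by simp
  qed
  ultimately show ?thesis using that by blast
qed

lemma selfadjoint_eigenvectors_orthogonal:
  fixes T :: "'a::real_inner \<Rightarrow> 'a"
  assumes "\<And>x y. T x \<bullet> y = x \<bullet> T y" "T v = x *\<^sub>R v" "T w = y *\<^sub>R w" "x \<noteq> y"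
  shows "v \<bullet> w = 0"
  using assms(1)[of v w] assms by simp

text \<open>For one eigenvalue \<open>x\<close>, the operator \<open>T - x\<close> is nonzero and
  commutes with \<open>T\<close>. An eigenvector of \<open>T\<close> outside its kernel has another
  eigenvalue.\<close>

lemma selfadjoint_nonscalar_eigenvectors:
  fixes T :: "'a::euclidean_space \<Rightarrow> 'a"
  assumes lin: "linear T" and sa: "\<And>x y. T x \<bullet> y = x \<bullet> T y"
    and nonscalar: "\<And>l. \<exists>u. T u \<noteq> l *\<^sub>R u"
  obtains v w x y where "norm v = 1" "norm w = 1" "v \<bullet> w = 0" "x \<noteq> y"
    "T v = x *\<^sub>R v" "T w = y *\<^sub>R w"
proof -
  have "\<exists>u. u \<noteq> (0::'a)"
    using nonscalar[of 0] lin by (metis linear_0 scale_zero_left)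
  then obtain v x where v: "v \<noteq> 0" "T v = x *\<^sub>R v"
    using selfadjoint_eigenvector_in_subspace[OF lin sa, of UNIV] by auto
  define P where "P z = T z - x *\<^sub>R z" for z
  have P: "linear P" unfolding P_def
    by (intro linear_compose_sub lin linear_scale_self)
  have sP: "P z \<bullet> u = z \<bullet> P u" for z u
    by (simp add: P_def inner_diff_left inner_diff_right sa)
  have cP: "T (P z) = P (T z)" for z
    by (simp add: P_def linear_diff[OF lin] linear_scale[OF lin])
  obtain u where "P u \<noteq> 0"
    using nonscalar[of x] by (auto simp: P_def)
  from selfadjoint_commuting_eigenvector[OF lin P sa sP cP this]
  obtain w y where w: "T w = y *\<^sub>R w" "P w \<noteq> 0" by blast
  have "x \<noteq> y" "w \<noteq> 0"
    using w linear_0[OF P] by (auto simp: P_def)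
  show thesis
  proof (rule that)
    show "norm (sgn v) = 1" "norm (sgn w) = 1"
      using v \<open>w \<noteq> 0\<close> by (simp_all add: norm_sgn)
    show "T (sgn v) = x *\<^sub>R sgn v" "T (sgn w) = y *\<^sub>R sgn w"
      using v w by (simp_all add: sgn_div_norm linear_scale[OF lin])
    then show "sgn v \<bullet> sgn w = 0"
      using sa \<open>x \<noteq> y\<close> by (rule_tac selfadjoint_eigenvectors_orthogonal)
  qed (rule \<open>x \<noteq> y\<close>)
qed

section \<open>The self-adjoint operator of a skew-Hermitian matrix\<close>

text \<open>The operator \<open>T\<close> of the overview. Being a function on a Euclidean space, it
  falls under the real self-adjoint theory above.\<close>

definition herm :: "complex ^ 'm ^ 'm \<Rightarrow> complex ^ 'm \<Rightarrow> complex ^ 'm" where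
  "herm X z = (- \<i>) *s (X *v z)"

lemma matrix_vector_eq_herm: "X *v z = \<i> *s herm X z"
  by (simp add: herm_def vector_smult_assoc)

lemma scaleR_vec_complex: "r *\<^sub>R (x :: complex ^ 'm) = complex_of_real r *s x"
  by (simp only: vec_eq_iff vector_scaleR_component vector_smult_component)
    (simp add: scaleR_conv_of_real)

lemma inner_eq_Re_hprod: "z \<bullet> w = Re (hprod z w)"
  by (simp add: inner_vec_def hprod_def inner_complex_def)

lemma hprod_scale_right: "hprod z (l *s w) = l * hprod z w"
  by (simp add: hprod_def sum_distrib_left mult_ac)

lemma hprod_scale_left: "hprod (l *s z) w = cnj l * hprod z w"
  by (simp add: hprod_def sum_distrib_left mult_ac)

lemma linear_herm: "linear (herm X)"
  by (rule linearI)
    (simp_all add: herm_def scaleR_vec_complex matrix_vector_right_distrib vector_add_ldistrib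
      vector_scalar_commute vector_smult_assoc mult.commute)

lemma herm_scale: "herm X (l *s z) = l *s herm X z"
  by (simp add: herm_def vector_scalar_commute vector_smult_assoc mult.commute)

lemma uminus_matrix_vector_mult: "(- A) *v (z :: complex ^ 'm) = - (A *v z)"
  by (simp add: vec_eq_iff matrix_vector_mult_def sum_negf)

lemma herm_selfadjoint:
  assumes "X \<in> \<uu>"
  shows "herm X z \<bullet> w = z \<bullet> herm X w"
proof -
  have "hprod (X *v z) w = - hprod z (X *v w)"
    using assms hprod_scale_right[of z "-1" "X *v w"]
    by (simp add: hprod_matrix \<uu>_def uminus_matrix_vector_mult vector_sneg_minus1[symmetric])
  then show ?thesis
    unfolding inner_eq_Re_hprod herm_def hprod_scale_left hprod_scale_right by simp
qed

lemma eigenvalues_herm: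
  "complex_of_real x * \<i> \<in> eigenvalues X \<longleftrightarrow> (\<exists>v. v \<noteq> 0 \<and> herm X v = x *\<^sub>R v)"
proof -
  have "X *v v = (complex_of_real x * \<i>) *s v \<longleftrightarrow> herm X v = x *\<^sub>R v" for v
    unfolding herm_def scaleR_vec_complex vec_eq_iff vector_smult_component
    by (intro iff_allI) (auto simp: complex_eq_iff)
  then show ?thesis by (simp add: eigenvalues_def)
qed

text \<open>Restriction to the sphere loses nothing: the standard basis vectors are unit vectors,
  and their images are the columns of the matrix.\<close>

lemma killing_field_inj: "inj killing_field"
proof (rule injI)
  fix X Y :: "complex ^ 'm ^ 'm"
  assume "killing_field X = killing_field Y"
  then have "X *v z = Y *v z" if "z \<in> sphere 0 1" for z
    using that by (metis killing_field_def restrict_apply')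
  then have "X *v axis k 1 = Y *v axis k 1" for k
    by (simp add: norm_eq_1 inner_axis_axis)
  moreover have "(A *v axis k 1) $ i = A $ i $ k" for A :: "complex ^ 'm ^ 'm" and i k
    by (simp add: matrix_vector_mult_def axis_def if_distrib cong: if_cong)
  ultimately show "X = Y"
    by (metis vec_eq_iff)
qed

section \<open>Central elements\<close>

lemma scalar_in_center:
  assumes "X \<in> \<uu>" "\<And>z. herm X z = x *\<^sub>R z"
  shows "X \<in> center_\<uu>"
proof -
  have X: "X *v z = (complex_of_real x * \<i>) *s z" for z
    by (simp add: matrix_vector_eq_herm assms(2) scaleR_vec_complex vector_smult_assoc mult.commute)
  have "X ** Y = Y ** X" for Y
    by (simp add: matrix_eq matrix_vector_mul_assoc[symmetric] X vector_scalar_commute)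
  then show ?thesis
    using assms(1) by (simp add: center_\<uu>_def lie_bracket_def)
qed

text \<open>
  The skew-Hermitian operator \<open>z \<mapsto> \<langle>v, z\<rangle> w - \<langle>w, z\<rangle> v\<close> commutes with \<open>X\<close> only if
  eigenvectors \<open>v\<close> and \<open>w\<close> of \<open>X\<close> have equal eigenvalues.
\<close>

lemma two_eigenvalues_not_in_center:
  assumes "v \<noteq> 0" "w \<noteq> 0" "herm X v = x *\<^sub>R v" "herm X w = y *\<^sub>R w" "x \<noteq> y"
  shows "X \<notin> center_\<uu>"
proof
  assume center: "X \<in> center_\<uu>"
  define Y where "Y = (\<chi> i j. w $ i * cnj (v $ j) - v $ i * cnj (w $ j))"
  have "Y \<in> \<uu>"
    by (simp add: \<uu>_def cadjoint_def Y_def vec_eq_iff mult.commute)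
  then have "X ** Y = Y ** X"
    using center by (simp add: center_\<uu>_def lie_bracket_def)
  then have comm: "herm X (Y *v z) = Y *v herm X z" for z
    unfolding herm_def vector_scalar_commute matrix_vector_mul_assoc by simp
  have Y: "Y *v z = hprod v z *s w - hprod w z *s v" for z
    by (simp add: Y_def matrix_vector_mult_def hprod_def vec_eq_iff sum_distrib_right
        sum_subtractf left_diff_distrib right_diff_distrib sum_distrib_left mult_ac)
  \<comment> \<open>At \<open>z = v\<close> the terms along \<open>v\<close> agree on both sides,
    which leaves a multiple of \<open>w\<close> with factor the squared norm of \<open>v\<close>
    times \<open>y - x\<close>.\<close>
  have "hprod v v *s (y *\<^sub>R w) - hprod w v *s (x *\<^sub>R v)
      = x *\<^sub>R (hprod v v *s w - hprod w v *s v)"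
    using comm[of v]
    by (simp add: Y assms linear_diff[OF linear_herm] herm_scale linear_scale[OF matrix_vector_mul_linear])
  then have "(hprod v v * complex_of_real (y - x)) *s w = 0"
    by (simp add: scaleR_vec_complex vec_eq_iff algebra_simps)
  then show False
    using assms by (simp add: hprod_self)
qed

section \<open>Killing fields of constant length\<close>

text \<open>Multiplication by the imaginary unit is an isometry, so the transverse part of
  \<open>X *v z\<close> has the norm of \<open>herm X z - q z\<close>. Pythagoras applies, since
  \<open>q\<close> is the coefficient of \<open>herm X z\<close> along the unit vector
  \<open>z\<close>.\<close>

lemma randers_herm:
  fixes z :: "complex ^ 'm"
  assumes "norm z = 1"
  shows "randers a b c z (X *v z) =
    sqrt (a * (z \<bullet> herm X z)\<^sup>2 + b * ((norm (herm X z))\<^sup>2 - (z \<bullet> herm X z)\<^sup>2)) + c * (z \<bullet> herm X z)"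
proof -
  define q where "q = z \<bullet> herm X z"
  have q: "Im (hprod z (X *v z)) = q"
    unfolding q_def inner_eq_Re_hprod herm_def hprod_scale_right by simp
  have "X *v z - (\<i> * complex_of_real q) *s z = \<i> *s (herm X z - q *\<^sub>R z)"
    by (simp add: matrix_vector_eq_herm scaleR_vec_complex vector_ssub_ldistrib vector_smult_assoc)
  moreover have "norm (\<i> *s u) = norm u" for u :: "complex ^ 'm"
    by (simp add: norm_vec_def norm_mult)
  ultimately have "norm (X *v z - (\<i> * complex_of_real q) *s z) = norm (herm X z - q *\<^sub>R z)"
    by metis
  moreover have "(norm (herm X z - q *\<^sub>R z))\<^sup>2 = (norm (herm X z))\<^sup>2 - q\<^sup>2"
    using assms
    unfolding power2_norm_eq_inner
    by (simp add: inner_diff_left inner_diff_right norm_eq_1 q_def inner_commute power2_eq_square)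
  ultimately show ?thesis
    by (simp add: randers_def q Let_def flip: q_def)
qed

lemma has_constant_length_killing_field:
  "has_constant_length F (killing_field X) L \<longleftrightarrow> (\<forall>z. norm z = 1 \<longrightarrow> F z (X *v z) = L)"
  by (auto simp: has_constant_length_def killing_field_def)

lemma inner_herm_square_le:
  assumes "norm z = 1"
  shows "(z \<bullet> herm X z)\<^sup>2 \<le> (norm (herm X z))\<^sup>2"
  using Cauchy_Schwarz_ineq[of z "herm X z"] assms by (simp add: power2_norm_eq_inner norm_eq_1)

text \<open>Squaring \<open>sqrt ?E = L - c * ?q\<close> removes the root. Going back requires the
  sign condition \<open>0 <= L - c * ?q\<close>.\<close>

lemma constant_length_quadratic:
  assumes "has_constant_length (randers a b c) (killing_field X) L"
    and "0 < a" "0 < b" "norm z = 1"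
  shows "(a - b - c\<^sup>2) * (z \<bullet> herm X z)\<^sup>2 + 2 * L * c * (z \<bullet> herm X z) + b * (norm (herm X z))\<^sup>2 = L\<^sup>2"
proof -
  let ?q = "z \<bullet> herm X z"
  let ?E = "a * ?q\<^sup>2 + b * ((norm (herm X z))\<^sup>2 - ?q\<^sup>2)"
  have "0 \<le> ?E"
    using assms inner_herm_square_le[of z X] by simp
  moreover have "sqrt ?E = L - c * ?q"
    using assms randers_herm[of z a b c X] by (simp add: has_constant_length_killing_field)
  ultimately have "?E = (L - c * ?q)\<^sup>2"
    by (metis real_sqrt_pow2)
  then show ?thesis
    by (simp add: power2_diff power_mult_distrib algebra_simps)
qed

lemma constant_length_imp_parameters:
  assumes "X \<in> \<uu>" "X \<notin> center_\<uu>" "0 < a" "0 < b"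
    and len: "has_constant_length (randers a b c) (killing_field X) L"
  shows "a = b + c\<^sup>2"
proof -
  obtain v w x y where vw: "norm v = 1" "norm w = 1" "v \<bullet> w = 0" "x \<noteq> y"
      and eig: "herm X v = x *\<^sub>R v" "herm X w = y *\<^sub>R w"
    using selfadjoint_nonscalar_eigenvectors[OF linear_herm herm_selfadjoint[OF assms(1)]]
      scalar_in_center[OF assms(1)] assms(2) by metis
  \<comment> \<open>The point with equal weights on \<open>v\<close> and \<open>w\<close>: both the
    form of \<open>herm X\<close> and its squared norm take there the mean of their values at
    \<open>v\<close> and \<open>w\<close>.\<close>
  define z where "z = (1 / sqrt 2) *\<^sub>R (v + w)"
  have Hz: "herm X z = (1 / sqrt 2) *\<^sub>R (x *\<^sub>R v + y *\<^sub>R w)"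
    by (simp add: z_def linear_scale[OF linear_herm] linear_add[OF linear_herm] eig)
  have ip: "v \<bullet> v = 1" "w \<bullet> w = 1" "w \<bullet> v = 0"
    using vw by (simp_all add: norm_eq_1 inner_commute)
  note simps = inner_add_left inner_add_right ip vw(3)
  have "norm z = 1"
    unfolding norm_eq_1 z_def by (simp add: simps)
  moreover have "z \<bullet> herm X z = (x + y) / 2"
    by (simp add: Hz) (simp add: z_def simps add_divide_distrib)
  moreover have "(norm (herm X z))\<^sup>2 = (x\<^sup>2 + y\<^sup>2) / 2"
    unfolding Hz power2_norm_eq_inner by (simp add: simps power2_eq_square add_divide_distrib)
  ultimately have z: "(a - b - c\<^sup>2) * ((x + y) / 2)\<^sup>2 + 2 * L * c * ((x + y) / 2) + b * ((x\<^sup>2 + y\<^sup>2) / 2) = L\<^sup>2"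
    using constant_length_quadratic[OF len assms(3,4)] by metis
  have v: "(a - b - c\<^sup>2) * x\<^sup>2 + 2 * L * c * x + b * x\<^sup>2 = L\<^sup>2"
    using constant_length_quadratic[OF len assms(3,4) vw(1)] ip vw by (simp add: eig)
  have w: "(a - b - c\<^sup>2) * y\<^sup>2 + 2 * L * c * y + b * y\<^sup>2 = L\<^sup>2"
    using constant_length_quadratic[OF len assms(3,4) vw(2)] ip vw by (simp add: eig)
  define A where "A = a - b - c\<^sup>2"
  \<comment> \<open>The deviation from the mean isolates the squared form, the only term that is not
    averaged at \<open>z\<close>.\<close>
  have "A * (x - y)\<^sup>2 = 2 * ((A * x\<^sup>2 + 2 * L * c * x + b * x\<^sup>2) + (A * y\<^sup>2 + 2 * L * c * y + b * y\<^sup>2)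
      - 2 * (A * ((x + y) / 2)\<^sup>2 + 2 * L * c * ((x + y) / 2) + b * ((x\<^sup>2 + y\<^sup>2) / 2)))"
    by (simp add: power2_eq_square field_simps)
  also have "\<dots> = 0"
    unfolding A_def z v w by simp
  finally show ?thesis
    using vw(4) by (simp add: A_def)
qed

text \<open>By Vieta, \<open>x\<close> and \<open>y\<close> are the roots of
  \<open>b t^2 + 2 L c t - L^2\<close>, so the operator here is the product of \<open>T - x\<close>
  and \<open>T - y\<close>. For \<open>a = b + c^2\<close> the squared length equation says that its
  quadratic form vanishes on the sphere.\<close>

lemma constant_length_iff_quadratic:
  assumes "X \<in> \<uu>" "0 < b" "0 < L" "x + y = - (2 * L * c / b)" "x * y = - (L\<^sup>2 / b)"
  shows "has_constant_length (randers (b + c\<^sup>2) b c) (killing_field X) L \<longleftrightarrow>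
    (\<forall>z. herm X (herm X z) - (x + y) *\<^sub>R herm X z + (x * y) *\<^sub>R z = 0)"
proof -
  define P where "P z = herm X (herm X z) - (x + y) *\<^sub>R herm X z + (x * y) *\<^sub>R z" for z
  note sa = herm_selfadjoint[OF assms(1)]
  have form: "b * (z \<bullet> P z) = 2 * L * c * (z \<bullet> herm X z) + b * (norm (herm X z))\<^sup>2 - L\<^sup>2 * (z \<bullet> z)" for z
    using \<open>0 < b\<close> unfolding P_def assms(4,5)
    by (simp add: inner_add_right inner_diff_right power2_norm_eq_inner sa field_simps)
  have "has_constant_length (randers (b + c\<^sup>2) b c) (killing_field X) L \<longleftrightarrow> (\<forall>z. P z = 0)"
  proof
    assume len: "has_constant_length (randers (b + c\<^sup>2) b c) (killing_field X) L"
    have unit: "z \<bullet> P z = 0" if "norm z = 1" for z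
      using constant_length_quadratic[OF len _ \<open>0 < b\<close> that] form[of z] \<open>0 < b\<close> that
      by (simp add: norm_eq_1 add_pos_nonneg)
    have lP: "linear P"
      unfolding P_def
      by (intro linear_compose_add linear_compose_sub linear_compose_scale_right linear_herm
          linear_compose[OF linear_herm linear_herm, unfolded o_def] linear_ident)
    have "z \<bullet> P z = 0" for z
    proof (cases "z = 0")
      case False
      then show ?thesis
        using unit[of "(1 / norm z) *\<^sub>R z"] by (simp add: linear_scale[OF lP])
    qed simp
    moreover have "P z \<bullet> u = z \<bullet> P u" for z u
      by (simp add: P_def inner_diff_left inner_diff_right inner_add_left inner_add_right sa)
    ultimately show "\<forall>z. P z = 0"
      using selfadjoint_eq_0[OF lP] by blast
  next
    assume P0: "\<forall>z. P z = 0"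
    have "randers (b + c\<^sup>2) b c z (X *v z) = L" if z: "norm z = 1" for z
    proof -
      define q where "q = z \<bullet> herm X z"
      have N: "b * (norm (herm X z))\<^sup>2 = L\<^sup>2 - 2 * L * c * q"
        using form[of z] P0 z by (simp add: norm_eq_1 q_def)
      \<comment> \<open>This settles the sign needed to undo the squaring: a nonnegative
        \<open>L * (L - 2 * (c * q))\<close> with \<open>L > 0\<close> bounds \<open>c * q\<close>
        by \<open>L / 2\<close>, hence by \<open>L\<close>.\<close>
      have "0 \<le> b * q\<^sup>2"
        using \<open>0 < b\<close> by simp
      also have "\<dots> \<le> b * (norm (herm X z))\<^sup>2"
        using inner_herm_square_le[OF z, of X] \<open>0 < b\<close> by (simp add: q_def)
      also have "\<dots> = L * (L - 2 * (c * q))"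
        unfolding N by (simp add: power2_eq_square algebra_simps)
      finally have "2 * (c * q) \<le> L"
        using \<open>0 < L\<close> by (simp add: zero_le_mult_iff)
      then have "0 \<le> L - c * q"
        using \<open>0 < L\<close> by linarith
      moreover have "(b + c\<^sup>2) * q\<^sup>2 + b * ((norm (herm X z))\<^sup>2 - q\<^sup>2) = (L - c * q)\<^sup>2"
        using N by algebra
      ultimately show ?thesis
        using randers_herm[OF z, of "b + c\<^sup>2" b c X] by (simp flip: q_def)
    qed
    then show "has_constant_length (randers (b + c\<^sup>2) b c) (killing_field X) L"
      by (simp add: has_constant_length_killing_field)
  qed
  then show ?thesis by (simp add: P_def)
qed

lemma constant_length_nonvanishing:
  assumes "has_constant_length (randers a b c) V L" "L \<noteq> 0"
  shows "nonvanishing V"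
proof -
  have "randers a b c z 0 = 0" for z
    by (simp add: randers_def hprod_def)
  then show ?thesis
    using assms by (metis has_constant_length_def nonvanishing_def)
qed

text \<open>An operator killed by a polynomial has its spectrum among the roots, and a missing root
  would make it scalar, so \<open>X\<close> central. Conversely, a nonzero value of the polynomial
  at \<open>T\<close> would yield an eigenvector of \<open>T\<close> whose eigenvalue is not a
  root.\<close>

lemma quadratic_iff_eigenvalues:
  assumes X: "X \<in> \<uu>" and "x \<noteq> y"
  shows "X \<notin> center_\<uu> \<and> (\<forall>z. herm X (herm X z) - (x + y) *\<^sub>R herm X z + (x * y) *\<^sub>R z = 0)
    \<longleftrightarrow> eigenvalues X = {complex_of_real x * \<i>, complex_of_real y * \<i>}"
    (is "?L \<longleftrightarrow> ?R")
proof
  assume L: ?L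
  have sub: "l \<in> {complex_of_real x * \<i>, complex_of_real y * \<i>}" if l: "l \<in> eigenvalues X" for l
  proof -
    obtain v where v: "v \<noteq> 0" "X *v v = l *s v"
      using l by (auto simp: eigenvalues_def)
    \<comment> \<open>An eigenvalue of \<open>X\<close> is a priori any complex number, so
      \<open>m\<close> is complex and is shown to be one of the real roots.\<close>
    define m where "m = - \<i> * l"
    have m: "herm X v = m *s v"
      by (simp add: herm_def v m_def vector_smult_assoc)
    have "((m - complex_of_real x) * (m - complex_of_real y)) *s v
        = herm X (herm X v) - (x + y) *\<^sub>R herm X v + (x * y) *\<^sub>R v"
      by (simp add: m herm_scale scaleR_vec_complex vec_eq_iff algebra_simps)
    then have "m = complex_of_real x \<or> m = complex_of_real y"
      using L v by simp
    moreover have "l = m * \<i>" by (simp add: m_def complex_eq_iff)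
    ultimately show ?thesis by auto
  qed
  \<comment> \<open>The symmetric hypotheses let \<open>r\<close> and \<open>s\<close> be the two
    roots in either order. Since \<open>T - r\<close> annihilates the range of \<open>T - s\<close>,
    any nonzero vector there is an eigenvector for \<open>r\<close>.\<close>
  have mem: "complex_of_real r * \<i> \<in> eigenvalues X"
    if rs: "r + s = x + y" "r * s = x * y" for r s
  proof -
    obtain z where "herm X z - s *\<^sub>R z \<noteq> 0"
      using scalar_in_center[OF X, of s] L by auto
    moreover have "herm X (herm X z - s *\<^sub>R z) = r *\<^sub>R (herm X z - s *\<^sub>R z)"
      using L[unfolded rs[symmetric]]
      by (simp add: linear_diff[OF linear_herm] linear_scale[OF linear_herm] algebra_simps)
    ultimately show ?thesis
      unfolding eigenvalues_herm by blast
  qed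
  show ?R
    using sub mem[of x y] mem[of y x] by (auto simp: add.commute mult.commute)
next
  assume R: ?R
  then obtain v w where "v \<noteq> 0" "herm X v = x *\<^sub>R v" "w \<noteq> 0" "herm X w = y *\<^sub>R w"
    using eigenvalues_herm[of x X] eigenvalues_herm[of y X] by auto
  then have "X \<notin> center_\<uu>"
    using two_eigenvalues_not_in_center \<open>x \<noteq> y\<close> by blast
  moreover have "herm X (herm X z) - (x + y) *\<^sub>R herm X z + (x * y) *\<^sub>R z = 0" for z
  proof (rule ccontr)
    define P where "P z = herm X (herm X z) - (x + y) *\<^sub>R herm X z + (x * y) *\<^sub>R z" for z
    note sa = herm_selfadjoint[OF X]
    have lP: "linear P"
      unfolding P_def
      by (intro linear_compose_add linear_compose_sub linear_compose_scale_right linear_herm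
          linear_compose[OF linear_herm linear_herm, unfolded o_def] linear_ident)
    have sP: "P z \<bullet> u = z \<bullet> P u" for z u
      by (simp add: P_def inner_diff_left inner_diff_right inner_add_left inner_add_right sa)
    have cP: "herm X (P z) = P (herm X z)" for z
      by (simp add: P_def linear_diff[OF linear_herm] linear_add[OF linear_herm] linear_scale[OF linear_herm])
    assume "herm X (herm X z) - (x + y) *\<^sub>R herm X z + (x * y) *\<^sub>R z \<noteq> 0"
    then have "P z \<noteq> 0" by (simp add: P_def)
    from selfadjoint_commuting_eigenvector[OF linear_herm lP sa sP cP this]
    obtain v r where v: "herm X v = r *\<^sub>R v" "P v \<noteq> 0" by blast
    have "v \<noteq> 0"
      using v linear_0[OF lP] by auto
    then have "complex_of_real r * \<i> \<in> eigenvalues X"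
      using v eigenvalues_herm by blast
    then have "r = x \<or> r = y"
      by (auto simp: R)
    moreover have "P v = ((r - x) * (r - y)) *\<^sub>R v"
      by (simp add: P_def v linear_scale[OF linear_herm] algebra_simps)
    ultimately show False
      using v by auto
  qed
  ultimately show ?L by blast
qed

text \<open>A diagonal matrix with \<open>x\<close> at one index and \<open>y\<close> at all others;
  the dimension bound ensures that both occur.\<close>

lemma exists_two_eigenvalues:
  assumes "2 \<le> CARD('m::finite)" and "x \<noteq> y"
  shows "\<exists>X :: complex ^ 'm ^ 'm. X \<in> \<uu> \<and>
    eigenvalues X = {complex_of_real x * \<i>, complex_of_real y * \<i>}"
proof -
  obtain k k' :: 'm where "k \<noteq> k'"
    using assms(1) by (metis UNIV_I card_2_iff' card_le_Suc0_iff_eq finite numeral_2_eq_2 not_less_eq_eq)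
  define d where "d i = (if i = k then x else y)" for i
  define X :: "complex ^ 'm ^ 'm" where
    "X = (\<chi> i j. if i = j then complex_of_real (d i) * \<i> else 0)"
  have X: "X \<in> \<uu>"
    by (auto simp: \<uu>_def X_def cadjoint_def vec_eq_iff)
  have H: "herm X z $ i = complex_of_real (d i) * z $ i" for z i
    by (simp add: herm_def X_def matrix_vector_mult_def if_distrib if_distribR cong: if_cong)
      (simp add: complex_eq_iff)
  have "herm X (axis k 1) = x *\<^sub>R axis k 1" "herm X (axis k' 1) = y *\<^sub>R axis k' 1"
    using \<open>k \<noteq> k'\<close> by (auto simp: vec_eq_iff H axis_def d_def scaleR_vec_complex)
  then have "X \<notin> center_\<uu>"
    using two_eigenvalues_not_in_center[of "axis k 1" "axis k' 1" X x y] \<open>x \<noteq> y\<close> by (simp add: axis_eq_0_iff)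
  moreover have "herm X (herm X z) - (x + y) *\<^sub>R herm X z + (x * y) *\<^sub>R z = 0" for z
    by (auto simp: vec_eq_iff H d_def scaleR_vec_complex algebra_simps)
  ultimately show ?thesis
    using quadratic_iff_eigenvalues[OF X \<open>x \<noteq> y\<close>] X by blast
qed

theorem theorem5p2:
  fixes n :: nat and a b c :: real
  assumes "CARD('m::finite) = n + 1" and "n \<ge> 1"
    and "a > 0" and "b > 0" and "0 < \<bar>c\<bar>" and "\<bar>c\<bar> < sqrt a"
  shows "((\<exists>X :: complex ^ 'm ^ 'm. X \<in> \<uu> \<and> X \<notin> center_\<uu> \<and>
            nonvanishing (killing_field X) \<and>
            (\<exists>L. has_constant_length (randers a b c) (killing_field X) L))
          \<longleftrightarrow> a = b + c\<^sup>2) \<and>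
    (a = b + c\<^sup>2 \<longrightarrow>
      (\<forall>L>0. bij_betw killing_field
         {X :: complex ^ 'm ^ 'm. X \<in> \<uu> \<and> card (eigenvalues X) = 2 \<and>
            eigenvalues X =
              {complex_of_real (- (L * c / b) + sqrt (L\<^sup>2 / b + L\<^sup>2 * c\<^sup>2 / b\<^sup>2)) * \<i>,
               complex_of_real (- (L * c / b) - sqrt (L\<^sup>2 / b + L\<^sup>2 * c\<^sup>2 / b\<^sup>2)) * \<i>}}
         {V. (\<exists>X :: complex ^ 'm ^ 'm. X \<in> \<uu> \<and> X \<notin> center_\<uu> \<and> V = killing_field X) \<and>
            has_constant_length (randers a b c) V L}))"
proof -
  \<comment> \<open>The sign \<open>s = 1\<close> or \<open>s = -1\<close> selects the root;
    \<open>add\<close> and \<open>mult\<close> are the Vieta relations for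
    \<open>b t^2 + 2 L c t - L^2\<close>.\<close>
  define ev where "ev L s = - (L * c / b) + s * sqrt (L\<^sup>2 / b + L\<^sup>2 * c\<^sup>2 / b\<^sup>2)" for L s
  have ne: "ev L 1 \<noteq> ev L (-1)" if "L > 0" for L
  proof -
    have "0 < L\<^sup>2 / b + L\<^sup>2 * c\<^sup>2 / b\<^sup>2"
      using that \<open>b > 0\<close> by (simp add: add_pos_nonneg)
    then show ?thesis by (simp add: ev_def)
  qed
  have add: "ev L 1 + ev L (-1) = - (2 * L * c / b)" for L
    by (simp add: ev_def)
  have mult: "ev L 1 * ev L (-1) = - (L\<^sup>2 / b)" for L
  proof -
    have "0 \<le> L\<^sup>2 / b + L\<^sup>2 * c\<^sup>2 / b\<^sup>2"
      using \<open>b > 0\<close> by simp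
    moreover have "ev L 1 * ev L (-1) = (L * c / b)\<^sup>2 - (sqrt (L\<^sup>2 / b + L\<^sup>2 * c\<^sup>2 / b\<^sup>2))\<^sup>2"
      by (simp add: ev_def power2_eq_square algebra_simps)
    ultimately show ?thesis
      by (simp add: power_divide power_mult_distrib)
  qed
  have char: "X \<notin> center_\<uu> \<and> has_constant_length (randers a b c) (killing_field X) L \<longleftrightarrow>
      eigenvalues X = {complex_of_real (ev L 1) * \<i>, complex_of_real (ev L (-1)) * \<i>}"
    if "a = b + c\<^sup>2" "L > 0" "X \<in> \<uu>" for L and X :: "complex ^ 'm ^ 'm"
    using constant_length_iff_quadratic[OF that(3) \<open>b > 0\<close> that(2) add mult]
      quadratic_iff_eigenvalues[OF that(3) ne[OF that(2)]] that(1) by blast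
  have "(\<exists>X :: complex ^ 'm ^ 'm. X \<in> \<uu> \<and> X \<notin> center_\<uu> \<and> nonvanishing (killing_field X) \<and>
      (\<exists>L. has_constant_length (randers a b c) (killing_field X) L)) \<longleftrightarrow> a = b + c\<^sup>2"
  proof
    assume "a = b + c\<^sup>2"
    moreover have "2 \<le> CARD('m)"
      using assms(1,2) by simp
    \<comment> \<open>The length is normalized to \<open>L = 1\<close>; being nonzero, it also makes
      the field nonvanishing.\<close>
    then obtain X :: "complex ^ 'm ^ 'm" where "X \<in> \<uu>"
      "eigenvalues X = {complex_of_real (ev 1 1) * \<i>, complex_of_real (ev 1 (-1)) * \<i>}"
      using exists_two_eigenvalues[OF _ ne[of 1]] by auto
    ultimately show "\<exists>X :: complex ^ 'm ^ 'm. X \<in> \<uu> \<and> X \<notin> center_\<uu> \<and> nonvanishing (killing_field X) \<and>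
        (\<exists>L. has_constant_length (randers a b c) (killing_field X) L)"
      using char[of 1 X] constant_length_nonvanishing[of a b c "killing_field X" 1] by auto
  qed (use constant_length_imp_parameters \<open>a > 0\<close> \<open>b > 0\<close> in blast)
  moreover have "bij_betw killing_field
      {X :: complex ^ 'm ^ 'm. X \<in> \<uu> \<and> card (eigenvalues X) = 2 \<and>
        eigenvalues X = {complex_of_real (ev L 1) * \<i>, complex_of_real (ev L (-1)) * \<i>}}
      {V. (\<exists>X :: complex ^ 'm ^ 'm. X \<in> \<uu> \<and> X \<notin> center_\<uu> \<and> V = killing_field X) \<and>
        has_constant_length (randers a b c) V L}" (is "bij_betw _ ?A ?B")
    if "a = b + c\<^sup>2" "L > 0" for L
  proof (rule bij_betw_imageI)
    show "inj_on killing_field ?A"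
      using killing_field_inj by (rule inj_on_subset) simp
    \<comment> \<open>Distinct roots supply the cardinality condition, so \<open>char\<close>
      identifies the domain with the non-central matrices whose fields have constant length
      \<open>L\<close>.\<close>
    have "card {complex_of_real (ev L 1) * \<i>, complex_of_real (ev L (-1)) * \<i>} = 2"
      using ne[OF that(2)] by simp
    with char[OF that] have "?A = {X. X \<in> \<uu> \<and> X \<notin> center_\<uu> \<and> has_constant_length (randers a b c) (killing_field X) L}"
      by (intro Collect_cong) metis
    then show "killing_field ` ?A = ?B"
      by auto
  qed
  ultimately show ?thesis
    by (simp add: ev_def)
qed

end
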